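(* Let $f:\mathbb{R}^n\to\mathbb{R}$ be continuously differentiable, bounded below with infimum $f_{\rm low}$, and $(\alpha,L_0,L_1)$-smooth for some $\alpha\in[0,1]$ and $L_0,L_1\ge 0$ (not both zero). Let the trust-region algorithm described in the context be applied to $f$, and assume there are $b_0,b_1\ge 0$ with $L_0\ge b_0$, $L_1\ge b_1$ such that $\|B_k\|\le b_0+b_1\|\nabla f(x_k)\|^\alpha$ for all $k\in\mathbb{N}$. Assume moreover that there exists $\mu>0$ such that $f(y)\ge f(x)+\nabla f(x)^T(y-x)+\frac12\mu\|y-x\|^2$ for all $x,y\in\mathbb{R}^n$. Assume that the algorithm generates infinitely many successful iterations. Let $\delta_k=f(x_k)-f_{\rm low}$, let $0<\epsilon<1$, let $\widehat{k}_\epsilon$ be the first iteration such that $\delta_{\widehat{k}_\epsilon}>\epsilon$ and $\delta_{\widehat{k}_\epsilon+1}\le\epsilon$, and let $\widehat{\mathcal{S}}(\epsilon)$ be the set of successful iterations $k$ with $k<\widehat{k}_\epsilon$. Define $$\widehat\kappa_0=\frac{1}{2\mu\eta_1\kappa_{\rm mdc}^2(1-\eta_2)\theta_{\min}},\qquad \widehat\kappa_\alpha=L_1\bigl(1+(\kappa_{\rm mdc}(1-\eta_2))^\alpha\bigr)\widehat\kappa_0.$$ Then, if $\alpha=0$, $$|\widehat{\mathcal{S}}(\epsilon)|\le(L_0+2L_1)\,\widehat\kappa_0\log(\delta_0/\epsilon),$$ and if $\alpha\in(0,1]$, $$|\widehat{\mathcal{S}}(\epsilon)|\le L_0\,\w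idehat\kappa_0\log(\delta_0/\epsilon)+\frac{2^{1+\alpha/2}\,\widehat\kappa_\alpha\,\mu^{\alpha/2}}{\alpha}\bigl(\delta_0^{\alpha/2}-\epsilon^{\alpha/2}\bigr).$$
   Context: Convention: $0^0=1$; $\|\cdot\|$ is the Euclidean norm and its induced matrix norm. Smoothness. A continuously differentiable $f$ is $(\alpha,L_0,L_1)$-smooth (with $L_0>0$ or $L_1>0$) if for all $x,y\in\mathbb{R}^n$, $\|\nabla f(x)-\nabla f(y)\|\le\bigl(L_0+L_1\int_0^1\|\nabla f(x+t(y-x))\|^\alpha dt\bigr)\|x-y\|$. Trust-region algorithm. Constants: $\kappa_{\rm mdc}\in(0,\frac12]$, $0<\eta_1\le\eta_2<1$, $0<\gamma_1\le\gamma_2<1\le\gamma_3$, $x_0\in\mathbb{R}^n$, $\Delta_0>0$. For $k=0,1,\dots$: choose a symmetric $B_k\in\mathbb{R}^{n\times n}$ and let $m_k(s)=f(x_k)+\nabla f(x_k)^Ts+\frac12s^TB_ks$; compute any $s_k$ with $\|s_k\|\le\Delta_k$ and $m_k(0)-m_k(s_k)\ge\kappa_{\rm mdc}\|\nabla f(x_k)\|\min\{\|\nabla f(x_k)\|/\|B_k\|,\Delta_k\}$ (with $\|\nabla f(x_k)\|/\|B_k\|=+\infty$ if $B_k=0$); set $\rho_k=\frac{f(x_k)-f(x_k+s_k)}{m_k(0)-m_k(s_k)}$; set $x_{k+1}=x_k+s_k$ if $\rho_k\ge\eta_1$ (successful iteration), and $x_{k+1}=x_k$ otherwise; choose $\Delta_{k+1}\in[\Delta_k,\gamma_3\Delta_k]$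 if $\rho_k\ge\eta_2$, $\Delta_{k+1}\in[\gamma_2\Delta_k,\Delta_k]$ if $\eta_1\le\rho_k<\eta_2$, and $\Delta_{k+1}\in[\gamma_1\Delta_k,\gamma_2\Delta_k]$ if $\rho_k<\eta_1$. Auxiliary functions. For $a\ge0,b>0$: $g(a,b)=\Bigl(1+\frac{(1-\alpha)L_1a^\alpha}{(L_0+L_1b^\alpha)^{1-\alpha}}\Bigr)^{1/(1-\alpha)}$ if $\alpha\in[0,1)$, and $g(a,b)=\exp(L_1a)$ if $\alpha=1$. For $b,t>0$, $h(b,t)$ is the unique $a>0$ with $a\,g(a,b)=t$. For $t>0$, $\psi(t)=\frac{t}{L_0+L_1t^\alpha}$. Finally $$\theta_{\min}=\gamma_1\min\Bigl\{1,\frac{\Delta_0}{h(\|\nabla f(x_0)\|,\kappa_{\rm mdc}(1-\eta_2)\psi(\|\nabla f(x_0)\|))}\Bigr\}.$$ *)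

theory Defs
  imports "HOL-Analysis.Analysis"
begin

text \<open>Real powers of nonnegative bases with the convention \<open>0\<^sup>0 = 1\<close>; the library has
  \<open>0 powr 0 = 0\<close>.\<close>

definition pow0 :: "real \<Rightarrow> real \<Rightarrow> real" where
  "pow0 a \<alpha> = (if a = 0 \<and> \<alpha> = 0 then 1 else a powr \<alpha>)"

definition has_continuous_gradient ::
    "('a::real_inner \<Rightarrow> real) \<Rightarrow> ('a \<Rightarrow> 'a) \<Rightarrow> bool" where
  "has_continuous_gradient f grad_f \<longleftrightarrow>
     (\<forall>x. GDERIV f x :> grad_f x) \<and> continuous_on UNIV grad_f"

definition general_smooth ::
    "real \<Rightarrow> real \<Rightarrow> real \<Rightarrow> ('a::real_inner \<Rightarrow> real) \<Rightarrow> ('a \<Rightarrow> 'a) \<Rightarrow> bool" where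
  "general_smooth \<alpha> L0 L1 f grad_f \<longleftrightarrow>
     has_continuous_gradient f grad_f \<and> (L0 > 0 \<or> L1 > 0) \<and>
     (\<forall>x y. norm (grad_f x - grad_f y)
        \<le> (L0 + L1 * integral {0..1} (\<lambda>t. pow0 (norm (grad_f (x + t *\<^sub>R (y - x)))) \<alpha>)) * norm (x - y))"

definition mat_norm :: "real^'n^'n \<Rightarrow> real" where
  "mat_norm B = onorm (\<lambda>v. B *v v)"

definition tr_model ::
    "(real^'n \<Rightarrow> real) \<Rightarrow> (real^'n \<Rightarrow> real^'n) \<Rightarrow> real^'n \<Rightarrow> real^'n^'n \<Rightarrow> real^'n \<Rightarrow> real" where
  "tr_model f grad_f x B s = f x + grad_f x \<bullet> s + 1/2 * (s \<bullet> (B *v s))"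

text \<open>The quantity \<open>min {\<parallel>g\<parallel> / \<parallel>B\<parallel>, \<Delta>}\<close>, where the quotient is \<open>+\<infinity>\<close> if \<open>B = 0\<close>.\<close>

definition decrease_radius :: "real^'n \<Rightarrow> real^'n^'n \<Rightarrow> real \<Rightarrow> real" where
  "decrease_radius g B \<Delta> = (if B = 0 then \<Delta> else min (norm g / mat_norm B) \<Delta>)"

text \<open>If the model decrease is \<open>0\<close> (possible only at a critical point), the quotient below is \<open>0\<close>
  by the library's convention, so that the iteration is not successful.\<close>

definition tr_ratio ::
    "(real^'n \<Rightarrow> real) \<Rightarrow> (real^'n \<Rightarrow> real^'n) \<Rightarrow> (nat \<Rightarrow> real^'n) \<Rightarrow> (nat \<Rightarrow> real^'n^'n)
      \<Rightarrow> (nat \<Rightarrow> real^'n) \<Rightarrow> nat \<Rightarrow> real" where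
  "tr_ratio f grad_f x B s k =
     (f (x k) - f (x k + s k))
       / (tr_model f grad_f (x k) (B k) 0 - tr_model f grad_f (x k) (B k) (s k))"

definition tr_constants ::
    "real \<Rightarrow> real \<Rightarrow> real \<Rightarrow> real \<Rightarrow> real \<Rightarrow> real \<Rightarrow> bool" where
  "tr_constants \<kappa>mdc \<eta>1 \<eta>2 \<gamma>1 \<gamma>2 \<gamma>3 \<longleftrightarrow>
     0 < \<kappa>mdc \<and> \<kappa>mdc \<le> 1/2 \<and> 0 < \<eta>1 \<and> \<eta>1 \<le> \<eta>2 \<and> \<eta>2 < 1 \<and>
     0 < \<gamma>1 \<and> \<gamma>1 \<le> \<gamma>2 \<and> \<gamma>2 < 1 \<and> 1 \<le> \<gamma>3"

text \<open>A run of the algorithm: the starting point and radius are \<open>x 0\<close> and \<open>\<Delta> 0\<close>, and the choices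
  left free by the algorithm (\<open>B\<close>, \<open>s\<close> and the new radii) are arbitrary sequences subject to its
  conditions.\<close>

definition trust_region_run ::
    "real \<Rightarrow> real \<Rightarrow> real \<Rightarrow> real \<Rightarrow> real \<Rightarrow> real
      \<Rightarrow> (real^'n \<Rightarrow> real) \<Rightarrow> (real^'n \<Rightarrow> real^'n)
      \<Rightarrow> (nat \<Rightarrow> real^'n) \<Rightarrow> (nat \<Rightarrow> real^'n^'n) \<Rightarrow> (nat \<Rightarrow> real^'n) \<Rightarrow> (nat \<Rightarrow> real) \<Rightarrow> bool" where
  "trust_region_run \<kappa>mdc \<eta>1 \<eta>2 \<gamma>1 \<gamma>2 \<gamma>3 f grad_f x B s \<Delta> \<longleftrightarrow>
     0 < \<Delta> 0 \<and>
     (\<forall>k. transpose (B k) = B k \<and>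
          norm (s k) \<le> \<Delta> k \<and>
          tr_model f grad_f (x k) (B k) 0 - tr_model f grad_f (x k) (B k) (s k)
            \<ge> \<kappa>mdc * norm (grad_f (x k)) * decrease_radius (grad_f (x k)) (B k) (\<Delta> k) \<and>
          (let \<rho> = tr_ratio f grad_f x B s k in
             x (Suc k) = (if \<rho> \<ge> \<eta>1 then x k + s k else x k) \<and>
             (\<rho> \<ge> \<eta>2 \<longrightarrow> \<Delta> (Suc k) \<in> {\<Delta> k .. \<gamma>3 * \<Delta> k}) \<and>
             (\<eta>1 \<le> \<rho> \<and> \<rho> < \<eta>2 \<longrightarrow> \<Delta> (Suc k) \<in> {\<gamma>2 * \<Delta> k .. \<Delta> k}) \<and>
             (\<rho> < \<eta>1 \<longrightarrow> \<Delta> (Suc k) \<in> {\<gamma>1 * \<Delta> k .. \<gamma>2 * \<Delta> k})))"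

definition successful_iterations ::
    "real \<Rightarrow> (real^'n \<Rightarrow> real) \<Rightarrow> (real^'n \<Rightarrow> real^'n) \<Rightarrow> (nat \<Rightarrow> real^'n) \<Rightarrow> (nat \<Rightarrow> real^'n^'n)
      \<Rightarrow> (nat \<Rightarrow> real^'n) \<Rightarrow> nat set" where
  "successful_iterations \<eta>1 f grad_f x B s = {k. tr_ratio f grad_f x B s k \<ge> \<eta>1}"

definition g_aux :: "real \<Rightarrow> real \<Rightarrow> real \<Rightarrow> real \<Rightarrow> real \<Rightarrow> real" where
  "g_aux \<alpha> L0 L1 a b =
     (if \<alpha> = 1 then exp (L1 * a)
      else (1 + (1 - \<alpha>) * L1 * pow0 a \<alpha> / (L0 + L1 * pow0 b \<alpha>) powr (1 - \<alpha>)) powr (1 / (1 - \<alpha>)))"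

definition h_aux :: "real \<Rightarrow> real \<Rightarrow> real \<Rightarrow> real \<Rightarrow> real \<Rightarrow> real" where
  "h_aux \<alpha> L0 L1 b t = (THE a. a > 0 \<and> a * g_aux \<alpha> L0 L1 a b = t)"

definition psi_aux :: "real \<Rightarrow> real \<Rightarrow> real \<Rightarrow> real \<Rightarrow> real" where
  "psi_aux \<alpha> L0 L1 t = t / (L0 + L1 * pow0 t \<alpha>)"

text \<open>Here \<open>G0\<close> stands for the norm of the gradient at the starting point.\<close>

definition theta_min ::
    "real \<Rightarrow> real \<Rightarrow> real \<Rightarrow> real \<Rightarrow> real \<Rightarrow> real \<Rightarrow> real \<Rightarrow> real \<Rightarrow> real" where
  "theta_min \<alpha> L0 L1 \<kappa>mdc \<eta>2 \<gamma>1 \<Delta>0 G0 =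
     \<gamma>1 * min 1 (\<Delta>0 / h_aux \<alpha> L0 L1 G0 (\<kappa>mdc * (1 - \<eta>2) * psi_aux \<alpha> L0 L1 G0))"

definition is_first_crossing :: "(nat \<Rightarrow> real) \<Rightarrow> real \<Rightarrow> nat \<Rightarrow> bool" where
  "is_first_crossing \<delta> \<epsilon> k \<longleftrightarrow>
     \<delta> k > \<epsilon> \<and> \<delta> (Suc k) \<le> \<epsilon> \<and> (\<forall>j<k. \<not> (\<delta> j > \<epsilon> \<and> \<delta> (Suc j) \<le> \<epsilon>))"

end

theory Submission
  imports Defs
begin

text \<open>Put \<open>c = \<kappa>mdc (1 - \<eta>2)\<close> and \<open>r(b) = c b / (L0 + L1 (1 + c\<^sup>\<alpha>) b\<^sup>\<alpha>)\<close>. On the ball of radius \<open>r(b)\<close> around a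
  point whose gradient has norm \<open>b\<close>, the gradient is Lipschitz towards the centre with the denominator
  of \<open>r(b)\<close> as constant, so an iteration whose radius is at most \<open>r(b)\<close> has ratio at least \<open>\<eta>2\<close>. By
  Bernoulli's inequality \<open>r(b) \<le> h(b, c \<psi>(b))\<close>, which is all that is needed about \<open>h\<close>. Strong
  convexity gives \<open>b\<^sub>k \<ge> \<beta>\<^sub>k = sqrt (2 \<mu> \<delta>\<^sub>k)\<close>. Unlike \<open>b\<^sub>k\<close>, the number \<open>\<beta>\<^sub>k\<close> is nonincreasing in \<open>k\<close>;
  as \<open>r\<close> is nondecreasing, induction yields \<open>\<Delta>\<^sub>k \<ge> \<theta>min r(\<beta>\<^sub>k)\<close>. A successful
  iteration then satisfies
  \<open>1 \<le> \<kappa>0 (L0 + L1 (1 + c\<^sup>\<alpha>) \<beta>\<^sub>k\<^sup>\<alpha>) (\<delta>\<^sub>k - \<delta>\<^sub>k\<^sub>+\<^sub>1) / \<delta>\<^sub>k\<close>, and comparing the right-hand side with the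
  integral of \<open>t\<^sup>-\<^sup>1\<close> and \<open>t\<^bsup>\<alpha>/2 - 1\<^esup>\<close> over \<open>[\<delta>\<^sub>k\<^sub>+\<^sub>1, \<delta>\<^sub>k]\<close> makes the sum telescope.\<close>

section \<open>Real powers and elementary inequalities\<close>

lemma pow0_nonneg: "0 \<le> pow0 a \<alpha>"
  by (simp add: pow0_def)

lemma pow0_pos: "0 < a \<Longrightarrow> 0 < pow0 a \<alpha>"
  by (simp add: pow0_def)

lemma pow0_mono: "0 \<le> a \<Longrightarrow> a \<le> b \<Longrightarrow> 0 \<le> \<alpha> \<Longrightarrow> pow0 a \<alpha> \<le> pow0 b \<alpha>"
  by (auto simp: pow0_def powr_mono2)

lemma pow0_mult: "0 \<le> a \<Longrightarrow> 0 \<le> b \<Longrightarrow> pow0 (a * b) \<alpha> = pow0 a \<alpha> * pow0 b \<alpha>"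
  by (auto simp: pow0_def powr_mult)

text \<open>Monotonicity of \<open>t powr (\<alpha> - 1)\<close>, which is nonincreasing for
  \<alpha> \<le> 1, in cross-multiplied form. Both the subadditivity of the power and the
  monotonicity of \<open>radius_bound\<close> rest on it.\<close>

lemma mult_pow0_le:
  assumes "0 < x" "x \<le> y" "\<alpha> \<le> 1"
  shows "x * pow0 y \<alpha> \<le> y * pow0 x \<alpha>"
proof -
  have "y powr \<alpha> = (y / x) powr \<alpha> * x powr \<alpha>"
    using assms by (simp flip: powr_mult)
  also have "\<dots> \<le> (y / x) powr 1 * x powr \<alpha>"
    using assms by (intro mult_right_mono powr_mono) auto
  finally show ?thesis
    using assms by (simp add: pow0_def field_simps)
qed

text \<open>For positive summands, compare each of \<open>a\<close> and \<open>b\<close> with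
  \<open>a + b\<close> by \<open>mult_pow0_le\<close>, add the two inequalities and cancel
  \<open>a + b\<close>.\<close>

lemma pow0_add_le:
  assumes "0 \<le> a" "0 \<le> b" "\<alpha> \<le> 1"
  shows "pow0 (a + b) \<alpha> \<le> pow0 a \<alpha> + pow0 b \<alpha>"
proof (cases "a = 0 \<or> b = 0")
  case True
  then show ?thesis by (auto simp: pow0_nonneg)
next
  case False
  then have pos: "0 < a" "0 < b" using assms by auto
  have "a * pow0 (a + b) \<alpha> \<le> (a + b) * pow0 a \<alpha>" "b * pow0 (a + b) \<alpha> \<le> (a + b) * pow0 b \<alpha>"
    using pos assms by (auto intro!: mult_pow0_le)
  then have "(a + b) * pow0 (a + b) \<alpha> \<le> (a + b) * (pow0 a \<alpha> + pow0 b \<alpha>)"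
    by (simp add: algebra_simps)
  then show ?thesis using pos by simp
qed

lemma continuous_on_pow0:
  assumes "continuous_on A w" "\<And>t. t \<in> A \<Longrightarrow> 0 \<le> w t" "0 \<le> \<alpha>"
  shows "continuous_on A (\<lambda>t. pow0 (w t) \<alpha>)"
proof (cases "\<alpha> = 0")
  case True
  have "pow0 (w t) \<alpha> = 1" for t using True by (simp add: pow0_def)
  then show ?thesis by simp
next
  case False
  have "pow0 (w t) \<alpha> = w t powr \<alpha>" for t using False by (simp add: pow0_def)
  then show ?thesis
    using assms False by (auto intro!: continuous_on_powr' continuous_on_const)
qed

text \<open>Bernoulli's inequality, read as the weighted arithmetic-geometric mean inequality for
  \<open>1 + y\<close> and \<open>1\<close> with weights \<alpha> and
  \<open>1 - \<alpha>\<close>.\<close>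

lemma powr_one_plus_le:
  assumes "0 \<le> \<alpha>" "\<alpha> \<le> 1" "0 \<le> (y::real)"
  shows "(1 + y) powr \<alpha> \<le> 1 + \<alpha> * y"
  using Youngs_inequality_0[of \<alpha> "1 - \<alpha>" "1 + y" 1] assms by (simp add: algebra_simps)

text \<open>The tangent of the concave function \<open>u powr p / p\<close> at \<open>s\<close> lies
  above its graph at \<open>t\<close>. It follows from the weighted mean inequality for
  \<open>t\<close> and \<open>s\<close>, multiplied by \<open>s powr p\<close>.\<close>

lemma powr_diff_ge:
  assumes "0 < t" "0 < s" "0 < p" "p \<le> (1::real)"
  shows "(s - t) * s powr p / s \<le> (s powr p - t powr p) / p"
proof -
  have "t powr p * s powr (1 - p) \<le> p * t + (1 - p) * s"
    using Youngs_inequality_0[of p "1 - p" t s] assms by simp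
  then have "t powr p * s \<le> (p * t + (1 - p) * s) * s powr p"
    using assms by (simp add: powr_diff field_simps)
  then show ?thesis
    using assms by (simp add: field_simps)
qed

section \<open>The safe radius and its monotonicity\<close>

definition radius_bound :: "real \<Rightarrow> real \<Rightarrow> real \<Rightarrow> real \<Rightarrow> real \<Rightarrow> real" where
  "radius_bound \<alpha> L0 L1 c b = c * b / (L0 + L1 * (1 + pow0 c \<alpha>) * pow0 b \<alpha>)"

lemma smooth_coeff_pos:
  assumes "0 \<le> L0" "0 \<le> L1" "L0 > 0 \<or> L1 > 0" "0 < b" "0 < q"
  shows "0 < L0 + L1 * q * pow0 b \<alpha>"
  using assms pow0_pos[of b \<alpha>] by (auto intro: add_pos_nonneg add_nonneg_pos)

text \<open>The factor \<open>q\<close> lets one proof serve two functions: \<open>q = 1\<close>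
  gives \<psi>, and \<open>q = 1 + pow0 c \<alpha>\<close> gives \<open>radius_bound\<close> up to
  the factor \<open>c\<close>.\<close>

lemma ratio_mono:
  assumes "0 \<le> L0" "0 \<le> L1" "L0 > 0 \<or> L1 > 0" "\<alpha> \<le> 1" "0 < b" "b \<le> b'" "0 < q"
  shows "b / (L0 + L1 * q * pow0 b \<alpha>) \<le> b' / (L0 + L1 * q * pow0 b' \<alpha>)"
proof -
  have pos: "0 < L0 + L1 * q * pow0 b \<alpha>" "0 < L0 + L1 * q * pow0 b' \<alpha>"
    using assms by (auto intro!: smooth_coeff_pos)
  have "b * L0 \<le> b' * L0" "L1 * q * (b * pow0 b' \<alpha>) \<le> L1 * q * (b' * pow0 b \<alpha>)"
    using assms by (auto intro!: mult_right_mono mult_left_mono mult_pow0_le)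
  then have "b * (L0 + L1 * q * pow0 b' \<alpha>) \<le> b' * (L0 + L1 * q * pow0 b \<alpha>)"
    by (simp add: algebra_simps)
  then show ?thesis using pos by (simp add: divide_le_eq le_divide_eq)
qed

lemma radius_bound_pos:
  assumes "0 \<le> L0" "0 \<le> L1" "L0 > 0 \<or> L1 > 0" "0 < b" "0 < c"
  shows "0 < radius_bound \<alpha> L0 L1 c b"
  using assms pow0_nonneg[of c \<alpha>] unfolding radius_bound_def
  by (intro divide_pos_pos smooth_coeff_pos mult_pos_pos) auto

lemma radius_bound_mono:
  assumes "0 \<le> L0" "0 \<le> L1" "L0 > 0 \<or> L1 > 0" "\<alpha> \<le> 1" "0 < b" "b \<le> b'" "0 < c"
  shows "radius_bound \<alpha> L0 L1 c b \<le> radius_bound \<alpha> L0 L1 c b'"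
  using mult_left_mono[OF ratio_mono[of L0 L1 \<alpha> b b' "1 + pow0 c \<alpha>"], of c] assms pow0_nonneg[of c \<alpha>]
  by (simp add: radius_bound_def)

lemma radius_bound_le:
  assumes "0 \<le> L0" "0 \<le> L1" "L0 > 0 \<or> L1 > 0" "0 < b" "0 \<le> c"
  shows "radius_bound \<alpha> L0 L1 c b \<le> c * (b / (L0 + L1 * pow0 b \<alpha>))"
proof -
  have "L1 * pow0 b \<alpha> \<le> L1 * (1 + pow0 c \<alpha>) * pow0 b \<alpha>"
    using assms pow0_nonneg[of c \<alpha>] pow0_nonneg[of b \<alpha>] by (simp add: algebra_simps)
  then show ?thesis
    using assms smooth_coeff_pos[of L0 L1 b 1 \<alpha>]
    unfolding radius_bound_def times_divide_eq_right
    by (intro divide_left_mono mult_pos_pos) auto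
qed

section \<open>Comparison of the safe radius with h\<close>

lemma g_aux_mono:
  assumes "0 \<le> \<alpha>" "\<alpha> \<le> 1" "0 \<le> L1" "0 \<le> a" "a \<le> a'"
  shows "g_aux \<alpha> L0 L1 a b \<le> g_aux \<alpha> L0 L1 a' b"
proof (cases "\<alpha> = 1")
  case True
  then show ?thesis using assms by (simp add: g_aux_def mult_left_mono)
next
  case False
  then show ?thesis
    using assms pow0_mono[of a a' \<alpha>] pow0_nonneg[of a \<alpha>]
    by (auto simp: g_aux_def intro!: powr_mono2 divide_right_mono mult_left_mono)
qed

lemma g_aux_ge_one:
  assumes "0 \<le> \<alpha>" "\<alpha> \<le> 1" "0 \<le> L1" "0 \<le> a"
  shows "1 \<le> g_aux \<alpha> L0 L1 a b"
  using assms pow0_nonneg[of a \<alpha>]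
  by (auto simp: g_aux_def intro!: ge_one_powr_ge_zero)

lemma continuous_on_g_aux:
  assumes "0 \<le> \<alpha>" "\<alpha> \<le> 1" "0 \<le> L1" "A \<subseteq> {0..}"
  shows "continuous_on A (\<lambda>a. g_aux \<alpha> L0 L1 a b)"
proof (cases "\<alpha> = 1")
  case True
  then show ?thesis by (auto simp: g_aux_def intro!: continuous_intros)
next
  case False
  have "1 + (1 - \<alpha>) * L1 * pow0 a \<alpha> / (L0 + L1 * pow0 b \<alpha>) powr (1 - \<alpha>) \<noteq> 0" for a
  proof -
    have "0 \<le> (1 - \<alpha>) * L1 * pow0 a \<alpha> / (L0 + L1 * pow0 b \<alpha>) powr (1 - \<alpha>)"
      using assms pow0_nonneg[of a \<alpha>] by simp
    then show ?thesis by linarith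
  qed
  then show ?thesis
    using assms False unfolding g_aux_def divide_inverse
    by (auto intro!: continuous_intros continuous_on_pow0)
qed

text \<open>The number \<open>y\<close> is chosen so that the denominator of
  \<open>radius_bound\<close> is \<open>A * (1 + y)\<close>. Then
  \<open>a = c * psi_aux \<alpha> L0 L1 b / (1 + y)\<close>, and it remains to show that
  \<open>g_aux \<alpha> L0 L1 a b\<close> is at most \<open>1 + y\<close>.\<close>

lemma radius_bound_mult_g_aux_le:
  assumes "0 \<le> \<alpha>" "\<alpha> \<le> 1" "0 \<le> L0" "0 \<le> L1" "L0 > 0 \<or> L1 > 0" "0 < b" "0 < c"
  defines "a \<equiv> radius_bound \<alpha> L0 L1 c b"
  shows "a * g_aux \<alpha> L0 L1 a b \<le> c * psi_aux \<alpha> L0 L1 b"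
proof -
  define A where "A = L0 + L1 * pow0 b \<alpha>"
  define y where "y = L1 * pow0 (c * b) \<alpha> / A"
  have A: "0 < A" unfolding A_def using smooth_coeff_pos[of L0 L1 b 1 \<alpha>] assms by simp
  have y: "0 \<le> y" unfolding y_def using A assms by (simp add: pow0_nonneg)
  have "L0 + L1 * (1 + pow0 c \<alpha>) * pow0 b \<alpha> = A * (1 + y)"
    using A assms by (simp add: A_def[symmetric] y_def pow0_mult distrib_left)
      (simp add: A_def algebra_simps)
  then have a: "a = c * b / (A * (1 + y))"
    by (simp add: a_def radius_bound_def)
  have apos: "0 < a" unfolding a_def using assms by (intro radius_bound_pos) auto
  have "g_aux \<alpha> L0 L1 a b \<le> 1 + y"
  proof (cases "\<alpha> = 1")
    case True
    have y': "y = L1 * (c * b) / A"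
      using True assms(6,7) by (simp add: y_def pow0_def)
    have "L1 * a = L1 * (c * b) / A / (1 + y)"
      by (simp add: a)
    also have "\<dots> = y / (1 + y)"
      by (simp only: y'[symmetric])
    also have "\<dots> \<le> ln (1 + y)"
    proof -
      have "ln (1 / (1 + y)) \<le> 1 / (1 + y) - 1"
        using y by (intro ln_le_minus_one) auto
      then show ?thesis
        using y by (simp add: ln_div field_simps)
    qed
    finally have "exp (L1 * a) \<le> exp (ln (1 + y))" by simp
    then show ?thesis using True y by (simp add: g_aux_def)
  next
    case False
    then have lt: "\<alpha> < 1" using assms by simp
    have pa: "pow0 a \<alpha> = pow0 (c * b) \<alpha> / (A powr \<alpha> * (1 + y) powr \<alpha>)"
      using A y assms(6,7) by (simp add: a pow0_def powr_divide powr_mult)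
    have "L1 * pow0 a \<alpha> / A powr (1 - \<alpha>) = y / (1 + y) powr \<alpha>"
      using A y by (simp add: pa y_def powr_diff)
    then have "1 + (1 - \<alpha>) * L1 * pow0 a \<alpha> / A powr (1 - \<alpha>) = 1 + (1 - \<alpha>) * (y / (1 + y) powr \<alpha>)"
      by (metis mult.assoc times_divide_eq_right)
    also have "\<dots> = ((1 + y) powr \<alpha> + (1 - \<alpha>) * y) / (1 + y) powr \<alpha>"
      using y by (simp add: field_simps)
    \<comment> \<open>By Bernoulli the numerator is at most
      \<open>1 + \<alpha> * y + (1 - \<alpha>) * y\<close>, which is \<open>1 + y\<close>.\<close>
    also have "\<dots> \<le> (1 + y) / (1 + y) powr \<alpha>"
      using powr_one_plus_le[of \<alpha> y] y assms by (intro divide_right_mono) (auto simp: algebra_simps)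
    also have "\<dots> = (1 + y) powr (1 - \<alpha>)"
      using y by (simp add: powr_diff)
    finally have "g_aux \<alpha> L0 L1 a b \<le> ((1 + y) powr (1 - \<alpha>)) powr (1 / (1 - \<alpha>))"
      unfolding g_aux_def A_def[symmetric] using False lt assms pow0_nonneg[of a \<alpha>]
      by (auto intro!: powr_mono2)
    then show ?thesis using lt y by (simp add: powr_powr)
  qed
  then have "a * g_aux \<alpha> L0 L1 a b \<le> a * (1 + y)"
    using apos by simp
  also have "\<dots> = c * psi_aux \<alpha> L0 L1 b"
    using A y by (simp add: a psi_aux_def A_def[symmetric])
  finally show ?thesis .
qed

text \<open>The map \<open>F\<close> is strictly increasing on the positive reals, is at most
  \<open>t\<close> at the safe radius and, since g is at least 1, at least \<open>t\<close> at
  \<open>t\<close>. So its root lies between these two points. Existence and uniqueness are both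
  needed to evaluate the description operator in \<open>h_aux\<close>.\<close>

lemma h_aux_ge_radius_bound:
  assumes "0 \<le> \<alpha>" "\<alpha> \<le> 1" "0 \<le> L0" "0 \<le> L1" "L0 > 0 \<or> L1 > 0" "0 < b" "0 < c"
  shows "radius_bound \<alpha> L0 L1 c b \<le> h_aux \<alpha> L0 L1 b (c * psi_aux \<alpha> L0 L1 b)"
proof -
  define a0 where "a0 = radius_bound \<alpha> L0 L1 c b"
  define t where "t = c * psi_aux \<alpha> L0 L1 b"
  define F where "F = (\<lambda>a. a * g_aux \<alpha> L0 L1 a b)"
  have a0: "0 < a0" unfolding a0_def using assms by (intro radius_bound_pos) auto
  have le: "a0 \<le> t" unfolding a0_def t_def psi_aux_def using assms by (intro radius_bound_le) auto
  have "F a0 \<le> t"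
    unfolding F_def a0_def t_def using assms by (intro radius_bound_mult_g_aux_le) auto
  moreover have "t \<le> F t"
    unfolding F_def using a0 le g_aux_ge_one[of \<alpha> L1 t L0 b] assms
    by (simp add: mult_le_cancel_left1)
  moreover have "continuous_on {a0..t} F"
    unfolding F_def using assms a0 by (intro continuous_intros continuous_on_g_aux) auto
  ultimately obtain a where a: "a0 \<le> a" "F a = t"
    using IVT'[of F a0 t t] le by auto
  have mono: "F u < F v" if "0 < u" "u < v" for u v
    unfolding F_def using that assms g_aux_mono[of \<alpha> L1 u v L0 b] g_aux_ge_one[of \<alpha> L1 u L0 b]
    by (intro mult_less_le_imp_less) auto
  have "h_aux \<alpha> L0 L1 b t = a"
    unfolding h_aux_def
  proof (rule the_equality)
    show "0 < a \<and> a * g_aux \<alpha> L0 L1 a b = t" using a a0 by (simp add: F_def)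
    show "u = a" if "0 < u \<and> u * g_aux \<alpha> L0 L1 u b = t" for u
      using that a a0 mono[of u a] mono[of a u] by (force simp: F_def)
  qed
  then show ?thesis using a by (simp add: a0_def t_def)
qed

section \<open>Local Lipschitz and descent estimates\<close>

text \<open>The gradient cannot leave the ball of radius \<open>c \<parallel>\<nabla>f(x)\<parallel>\<close> along the segment: as long as it
  stays inside, the smoothness condition holds with the constant \<open>D\<close>, which confines it strictly
  inside up to the end of the segment.\<close>

lemma gradient_lipschitz_within_radius_bound:
  fixes f :: "'a::real_inner \<Rightarrow> real"
  assumes smooth: "general_smooth \<alpha> L0 L1 f grad_f"
    and par: "0 \<le> \<alpha>" "\<alpha> \<le> 1" "0 \<le> L0" "0 \<le> L1"
    and b: "0 < norm (grad_f x)" and c: "0 < c"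
    and d: "norm d \<le> radius_bound \<alpha> L0 L1 c (norm (grad_f x))"
    and t: "0 \<le> t" "t \<le> 1"
  defines "D \<equiv> L0 + L1 * (1 + pow0 c \<alpha>) * pow0 (norm (grad_f x)) \<alpha>"
  shows "norm (grad_f (x + t *\<^sub>R d) - grad_f x) \<le> D * norm d * t"
proof -
  define b where "b = norm (grad_f x)"
  define \<phi> where "\<phi> = (\<lambda>t. norm (grad_f (x + t *\<^sub>R d) - grad_f x))"
  have cont: "continuous_on UNIV grad_f" and L: "L0 > 0 \<or> L1 > 0"
    using smooth by (auto simp: general_smooth_def has_continuous_gradient_def)
  have cg: "continuous_on A (\<lambda>t. grad_f (p t))" if "continuous_on A p" for p :: "real \<Rightarrow> 'a" and A
    using continuous_on_compose2[OF cont that] by simp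
  have D: "0 < D" unfolding D_def
    using smooth_coeff_pos[of L0 L1 "norm (grad_f x)" "1 + pow0 c \<alpha>" \<alpha>] par L assms pow0_nonneg[of c \<alpha>]
    by simp
  have Dd: "D * norm d \<le> c * b"
  proof -
    have "norm d \<le> c * b / D" using d unfolding radius_bound_def D_def b_def .
    then show ?thesis unfolding pos_le_divide_eq[OF D] by (simp only: mult.commute)
  qed
  have inside: "\<phi> u \<le> D * norm d * u" if u: "0 \<le> u" "u \<le> 1" and le: "\<And>v. 0 \<le> v \<Longrightarrow> v \<le> u \<Longrightarrow> \<phi> v \<le> c * b" for u
  proof -
    let ?G = "\<lambda>r. pow0 (norm (grad_f (x + r *\<^sub>R (x + u *\<^sub>R d - x)))) \<alpha>"
    have "?G r \<le> pow0 b \<alpha> + pow0 c \<alpha> * pow0 b \<alpha>" if r: "r \<in> {0..1}" for r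
    proof -
      \<comment> \<open>The point with parameter \<open>r\<close> on the segment from
        \<open>x\<close> to \<open>x + u *\<^sub>R d\<close> has parameter \<open>r * u\<close> on
        the full segment, hence lies where the bound is assumed.\<close>
      have "\<phi> (r * u) \<le> c * b" using r u by (intro le) (auto intro: mult_left_le_one_le)
      then have "norm (grad_f (x + (r * u) *\<^sub>R d)) \<le> b + c * b"
        using norm_triangle_ineq[of "grad_f x" "grad_f (x + (r * u) *\<^sub>R d) - grad_f x"]
        by (simp add: \<phi>_def b_def)
      then have "?G r \<le> pow0 (b + c * b) \<alpha>"
        using par by (intro pow0_mono) auto
      \<comment> \<open>Subadditivity of the power is the source of the factor
        \<open>1 + pow0 c \<alpha>\<close> in \<open>D\<close> and in
        \<open>radius_bound\<close>.\<close>
      also have "\<dots> \<le> pow0 b \<alpha> + pow0 (c * b) \<alpha>"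
        using par c by (intro pow0_add_le) (auto simp: b_def)
      finally show ?thesis using c by (simp add: pow0_mult b_def)
    qed
    moreover have "?G integrable_on {0..1}"
      using par by (intro integrable_continuous_interval continuous_on_pow0 continuous_intros cg) auto
    ultimately have int: "integral {0..1} ?G \<le> pow0 b \<alpha> + pow0 c \<alpha> * pow0 b \<alpha>"
      using integral_le[of ?G "{0..1}" "\<lambda>_. pow0 b \<alpha> + pow0 c \<alpha> * pow0 b \<alpha>"] by auto
    have "\<phi> u \<le> (L0 + L1 * integral {0..1} ?G) * norm (x - (x + u *\<^sub>R d))"
      unfolding \<phi>_def norm_minus_commute[of _ "grad_f x"]
      using smooth by (auto simp only: general_smooth_def)
    also have "\<dots> \<le> D * norm (x - (x + u *\<^sub>R d))"
      using mult_left_mono[OF int par(4)]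
      by (intro mult_right_mono) (auto simp: D_def b_def algebra_simps)
    finally show ?thesis using u by (simp add: mult.assoc mult.commute[of u])
  qed
  have contphi: "continuous_on A \<phi>" for A
    unfolding \<phi>_def by (intro continuous_intros cg)
  have cb: "0 < c * b" using c assms by (simp add: b_def)
  have small: "\<phi> u < c * b" if u: "0 \<le> u" "u < 1" for u
  proof (rule ccontr)
    assume "\<not> \<phi> u < c * b"
    \<comment> \<open>Since \<phi> vanishes at 0, it would have to take the value
      \<open>c * b\<close>. The compact set \<open>E\<close> then has a least element
      \<open>w\<close>, and \<phi> cannot exceed \<open>c * b\<close> before \<open>w\<close>
      without an earlier hit.\<close>
    define E where "E = {v \<in> {0..u}. \<phi> v = c * b}"
    have hit: "\<exists>v. 0 \<le> v \<and> v \<le> w \<and> \<phi> v = c * b" if "0 \<le> w" "c * b \<le> \<phi> w" for w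
      using IVT'[of \<phi> 0 "c * b" w] that cb contphi by (auto simp: \<phi>_def)
    have "E \<noteq> {}" using hit[of u] u \<open>\<not> \<phi> u < c * b\<close> by (auto simp: E_def)
    moreover have "compact E"
      unfolding compact_eq_bounded_closed
    proof
      show "bounded E" by (rule bounded_subset[of "{0..u}"]) (auto simp: E_def)
      show "closed E"
        unfolding E_def by (rule continuous_closed_preimage_constant[OF contphi]) simp
    qed
    ultimately obtain w where w: "w \<in> E" "\<And>v. v \<in> E \<Longrightarrow> w \<le> v"
      using compact_attains_inf by metis
    have "\<phi> v \<le> c * b" if v: "0 \<le> v" "v \<le> w" for v
    proof (rule ccontr)
      assume "\<not> \<phi> v \<le> c * b"
      then obtain v' where v': "0 \<le> v'" "v' \<le> v" "\<phi> v' = c * b"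
        using hit[of v] v by auto
      then have "v' \<in> E" using v w by (auto simp: E_def)
      then have "v' = w" using w(2)[of v'] v' v by auto
      then show False using v' v \<open>\<not> \<phi> v \<le> c * b\<close> by (cases "v = w") auto
    qed
    then have "\<phi> w \<le> D * norm d * w"
      using w u by (intro inside) (auto simp: E_def)
    also have "\<dots> \<le> c * b * w"
      using w Dd by (intro mult_right_mono) (auto simp: E_def)
    \<comment> \<open>The strict inequality uses \<open>w < 1\<close>; for this reason the end point
      1 is treated separately, by continuity from the left.\<close>
    also have "\<dots> < c * b * 1"
      using w u cb by (intro mult_strict_left_mono) (auto simp: E_def)
    finally show False using w by (simp add: E_def)
  qed
  show ?thesis
  proof (cases "t < 1")
    case True
    then show ?thesis
      using inside[of t] t small by (force simp: \<phi>_def intro: less_imp_le)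
  next
    case False
    have "\<phi> 1 \<le> c * b"
    proof (rule tendsto_upperbound)
      show "(\<phi> \<longlongrightarrow> \<phi> 1) (at_left 1)"
        using contphi[of UNIV] by (auto simp: continuous_on_def intro: tendsto_within_subset)
      show "\<forall>\<^sub>F u in at_left 1. \<phi> u \<le> c * b"
        using small by (auto simp: eventually_at_left[of 0] intro!: exI[of _ 0] less_imp_le)
    qed auto
    then have "\<phi> v \<le> c * b" if "0 \<le> v" "v \<le> 1" for v
      using that small[of v] by (cases "v = 1") auto
    then show ?thesis
      using inside[of t] t by (simp add: \<phi>_def)
  qed
qed

text \<open>The usual descent argument: subtracting the quadratic upper model from \<open>f\<close>
  along the segment leaves a function \<open>p\<close> with nonpositive derivative. Only gradient
  differences with the centre \<open>x\<close> enter, so the preceding local estimate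
  suffices.\<close>

lemma descent_within_radius_bound:
  fixes f :: "'a::real_inner \<Rightarrow> real"
  assumes smooth: "general_smooth \<alpha> L0 L1 f grad_f"
    and par: "0 \<le> \<alpha>" "\<alpha> \<le> 1" "0 \<le> L0" "0 \<le> L1"
    and b: "0 < norm (grad_f x)" and c: "0 < c"
    and d: "norm d \<le> radius_bound \<alpha> L0 L1 c (norm (grad_f x))"
  defines "D \<equiv> L0 + L1 * (1 + pow0 c \<alpha>) * pow0 (norm (grad_f x)) \<alpha>"
  shows "f (x + d) \<le> f x + grad_f x \<bullet> d + D * (norm d)\<^sup>2 / 2"
proof -
  define p where "p = (\<lambda>t. f (x + t *\<^sub>R d) - t * (grad_f x \<bullet> d) - D * (norm d)\<^sup>2 * t\<^sup>2 / 2)"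
  have der: "(p has_real_derivative
      grad_f (x + t *\<^sub>R d) \<bullet> d - grad_f x \<bullet> d - D * (norm d)\<^sup>2 * t) (at t)" for t
  proof -
    have "(f has_derivative (\<lambda>h. grad_f (x + t *\<^sub>R d) \<bullet> h)) (at (x + t *\<^sub>R d))"
      using smooth
      by (simp add: general_smooth_def has_continuous_gradient_def gderiv_def inner_commute)
    then have "((\<lambda>t. f (x + t *\<^sub>R d)) has_derivative (\<lambda>h. grad_f (x + t *\<^sub>R d) \<bullet> (h *\<^sub>R d))) (at t)"
      by (rule has_derivative_compose[rotated]) (auto intro!: derivative_eq_intros)
    then have "((\<lambda>t. f (x + t *\<^sub>R d)) has_real_derivative grad_f (x + t *\<^sub>R d) \<bullet> d) (at t)"
      by (simp add: has_field_derivative_def mult.commute[of _ "_ \<bullet> _"])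
    then show ?thesis
      unfolding p_def by (auto intro!: derivative_eq_intros)
  qed
  have "p 1 \<le> p 0"
  proof (rule DERIV_nonpos_imp_nonincreasing[of 0 1])
    show "\<exists>y. (p has_real_derivative y) (at t) \<and> y \<le> 0" if t: "0 \<le> t" "t \<le> 1" for t
    proof (intro exI conjI)
      show "(p has_real_derivative
          grad_f (x + t *\<^sub>R d) \<bullet> d - grad_f x \<bullet> d - D * (norm d)\<^sup>2 * t) (at t)" by (rule der)
      have "(grad_f (x + t *\<^sub>R d) - grad_f x) \<bullet> d \<le> norm (grad_f (x + t *\<^sub>R d) - grad_f x) * norm d"
        by (rule norm_cauchy_schwarz)
      also have "\<dots> \<le> D * norm d * t * norm d"
        unfolding D_def using gradient_lipschitz_within_radius_bound[OF smooth par b c d t]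
        by (intro mult_right_mono) auto
      finally show "grad_f (x + t *\<^sub>R d) \<bullet> d - grad_f x \<bullet> d - D * (norm d)\<^sup>2 * t \<le> 0"
        by (simp add: inner_diff_left power2_eq_square algebra_simps)
    qed
  qed simp
  then show ?thesis by (simp add: p_def)
qed

section \<open>Acceptance of steps with a small radius\<close>

lemma mat_norm_nonneg: "0 \<le> mat_norm B"
  unfolding mat_norm_def by (intro onorm_pos_le matrix_vector_mul_bounded_linear)

lemma mat_norm_eq_0_iff: "mat_norm B = 0 \<longleftrightarrow> B = 0"
  unfolding mat_norm_def onorm_eq_0[OF matrix_vector_mul_bounded_linear]
  by (simp add: matrix_eq)

lemma inner_mat_norm_bound: "\<bar>s \<bullet> (B *v s)\<bar> \<le> mat_norm B * (norm s)\<^sup>2"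
proof -
  have "\<bar>s \<bullet> (B *v s)\<bar> \<le> norm s * norm (B *v s)"
    by (rule Cauchy_Schwarz_ineq2)
  also have "\<dots> \<le> norm s * (mat_norm B * norm s)"
    unfolding mat_norm_def by (intro mult_left_mono onorm matrix_vector_mul_bounded_linear) auto
  finally show ?thesis by (simp add: power2_eq_square algebra_simps)
qed

lemma decrease_radius_ge:
  assumes "mat_norm B \<le> A" "0 < A"
  shows "min (norm g / A) \<Delta> \<le> decrease_radius g B \<Delta>"
proof (cases "B = 0")
  case False
  then have "0 < mat_norm B"
    using mat_norm_nonneg[of B] mat_norm_eq_0_iff[of B] by linarith
  then have "norm g / A \<le> norm g / mat_norm B"
    using assms by (intro divide_left_mono) auto
  then show ?thesis by (auto simp: decrease_radius_def)
qed (simp add: decrease_radius_def)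

lemma decrease_radius_nonneg: "0 \<le> \<Delta> \<Longrightarrow> 0 \<le> decrease_radius g B \<Delta>"
  by (simp add: decrease_radius_def mat_norm_nonneg)

text \<open>For such a radius the model decrease \<open>M\<close> is at least
  \<open>\<kappa> * b * \<Delta>\<close>, while \<open>f\<close> exceeds the model at the trial
  point by at most \<open>D * \<Delta>\<^sup>2\<close>, hence by at most
  \<open>(1 - \<eta>) * \<kappa> * b * \<Delta>\<close> and so by at most
  \<open>(1 - \<eta>) * M\<close>.\<close>

lemma tr_ratio_ge_of_small_radius:
  fixes f :: "real^'n \<Rightarrow> real"
  assumes smooth: "general_smooth \<alpha> L0 L1 f grad_f"
    and par: "0 \<le> \<alpha>" "\<alpha> \<le> 1" "0 \<le> L0" "0 \<le> L1"
    and b: "0 < norm (grad_f (x k))"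
    and \<kappa>: "0 < \<kappa>" "\<kappa> \<le> 1" and \<eta>: "0 < \<eta>" "\<eta> < 1"
    and B: "mat_norm (B k) \<le> L0 + L1 * pow0 (norm (grad_f (x k))) \<alpha>"
    and \<Delta>: "0 < \<Delta>" "\<Delta> \<le> radius_bound \<alpha> L0 L1 (\<kappa> * (1 - \<eta>)) (norm (grad_f (x k)))"
    and s: "norm (s k) \<le> \<Delta>"
    and dec: "tr_model f grad_f (x k) (B k) 0 - tr_model f grad_f (x k) (B k) (s k)
            \<ge> \<kappa> * norm (grad_f (x k)) * decrease_radius (grad_f (x k)) (B k) \<Delta>"
  shows "\<eta> \<le> tr_ratio f grad_f x B s k"
proof -
  define b where "b = norm (grad_f (x k))"
  define c where "c = \<kappa> * (1 - \<eta>)"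
  define A where "A = L0 + L1 * pow0 b \<alpha>"
  define D where "D = L0 + L1 * (1 + pow0 c \<alpha>) * pow0 b \<alpha>"
  define M where "M = tr_model f grad_f (x k) (B k) 0 - tr_model f grad_f (x k) (B k) (s k)"
  have L: "L0 > 0 \<or> L1 > 0" using smooth by (simp add: general_smooth_def)
  have b0: "0 < b" using b by (simp add: b_def)
  have c0: "0 < c" "c \<le> 1" using \<kappa> \<eta> by (auto simp: c_def mult_le_one)
  have A0: "0 < A" unfolding A_def using smooth_coeff_pos[of L0 L1 b 1 \<alpha>] par L b0 by simp
  have AD: "A \<le> D" unfolding A_def D_def
    using par pow0_nonneg[of c \<alpha>] pow0_nonneg[of b \<alpha>] by (simp add: algebra_simps)
  have "\<Delta> \<le> c * (b / A)"
    unfolding A_def using \<Delta> radius_bound_le[of L0 L1 b c \<alpha>] par L b0 c0 by (simp add: b_def c_def)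
  \<comment> \<open>Thus the minimum in the decrease condition is attained by the radius.\<close>
  also have "\<dots> \<le> 1 * (b / A)" using c0 b0 A0 by (intro mult_right_mono) auto
  finally have "decrease_radius (grad_f (x k)) (B k) \<Delta> \<ge> \<Delta>"
    using decrease_radius_ge[of "B k" A "grad_f (x k)" \<Delta>] B A0 by (simp add: A_def b_def)
  then have "\<kappa> * b * \<Delta> \<le> \<kappa> * b * decrease_radius (grad_f (x k)) (B k) \<Delta>"
    using \<kappa> b0 by (intro mult_left_mono) auto
  then have M: "\<kappa> * b * \<Delta> \<le> M" using dec by (simp add: M_def b_def)
  have M0: "M = f (x k) - tr_model f grad_f (x k) (B k) (s k)"
    by (simp add: M_def tr_model_def)
  have Mpos: "0 < M" using M mult_pos_pos[OF mult_pos_pos[OF \<kappa>(1) b0] \<Delta>(1)] by linarith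
  have "f (x k + s k) \<le> f (x k) + grad_f (x k) \<bullet> s k + D * (norm (s k))\<^sup>2 / 2"
    unfolding D_def b_def using s \<Delta> c0
    by (intro descent_within_radius_bound[OF smooth par b c0(1)]) (auto simp: c_def)
  \<comment> \<open>The smoothness remainder and the quadratic term of the model each contribute
    half of \<open>D * (norm (s k))\<^sup>2\<close> to the model error.\<close>
  moreover have "- (s k \<bullet> (B k *v s k)) \<le> D * (norm (s k))\<^sup>2"
  proof -
    have "mat_norm (B k) * (norm (s k))\<^sup>2 \<le> D * (norm (s k))\<^sup>2"
      using B AD by (intro mult_right_mono) (auto simp: A_def b_def)
    then show ?thesis using inner_mat_norm_bound[of "s k" "B k"] by linarith
  qed
  ultimately have "f (x k + s k) - tr_model f grad_f (x k) (B k) (s k) \<le> D * (norm (s k))\<^sup>2"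
    by (simp add: tr_model_def)
  also have "\<dots> \<le> D * \<Delta>\<^sup>2"
    using s A0 AD by (intro mult_left_mono power_mono) auto
  also have "\<dots> \<le> c * b * \<Delta>"
  proof -
    have "0 < D" using A0 AD by simp
    have "\<Delta> \<le> c * b / D" using \<Delta>(2) unfolding radius_bound_def D_def b_def c_def .
    then have "D * \<Delta> \<le> c * b" unfolding pos_le_divide_eq[OF \<open>0 < D\<close>] by (simp only: mult.commute)
    then have "D * \<Delta> * \<Delta> \<le> c * b * \<Delta>" using \<Delta> by (intro mult_right_mono) auto
    then show ?thesis by (simp add: power2_eq_square mult.assoc)
  qed
  also have "\<dots> \<le> M - \<eta> * M"
    using mult_left_mono[OF M, of "1 - \<eta>"] \<eta> by (simp add: c_def algebra_simps)
  finally have "\<eta> * M \<le> f (x k) - f (x k + s k)"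
    using M0 by linarith
  then show ?thesis
    using Mpos by (simp add: tr_ratio_def M_def[symmetric] field_simps)
qed

section \<open>Decrease, gradient domination and counting\<close>

lemma successful_decrease:
  assumes "0 < \<eta>" "\<eta> \<le> tr_ratio f grad_f x B s k"
    and "q \<le> tr_model f grad_f (x k) (B k) 0 - tr_model f grad_f (x k) (B k) (s k)" "0 \<le> q"
  shows "\<eta> * q \<le> f (x k) - f (x k + s k)"
proof -
  define M where "M = tr_model f grad_f (x k) (B k) 0 - tr_model f grad_f (x k) (B k) (s k)"
  \<comment> \<open>Division by zero would make the ratio 0, below the positive threshold.\<close>
  have "M \<noteq> 0" using assms by (auto simp: tr_ratio_def M_def)
  then have "0 < M" using assms by (simp add: M_def)
  then have "\<eta> * M \<le> f (x k) - f (x k + s k)"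
    using assms(2) by (simp add: tr_ratio_def M_def[symmetric] field_simps)
  moreover have "\<eta> * q \<le> \<eta> * M" using assms by (simp add: M_def)
  ultimately show ?thesis by linarith
qed

text \<open>The Polyak-Lojasiewicz inequality. Completing the square in \<open>norm (v - u)\<close>
  bounds the quadratic minorant of \<open>f\<close> from below uniformly in \<open>v\<close>, and
  this bound passes to the infimum.\<close>

lemma strongly_convex_gradient_domination:
  fixes f :: "'a::real_inner \<Rightarrow> real"
  assumes "0 < \<mu>" "\<And>v. f v \<ge> f u + grad_f u \<bullet> (v - u) + 1/2 * \<mu> * (norm (v - u))\<^sup>2"
  shows "2 * \<mu> * (f u - Inf (range f)) \<le> (norm (grad_f u))\<^sup>2"
proof -
  have "f u - (norm (grad_f u))\<^sup>2 / (2 * \<mu>) \<le> f v" for v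
  proof -
    have "- (norm (grad_f u) * norm (v - u)) \<le> grad_f u \<bullet> (v - u)"
      using Cauchy_Schwarz_ineq2[of "grad_f u" "v - u"] by linarith
    moreover have "0 \<le> (norm (grad_f u) - \<mu> * norm (v - u))\<^sup>2 / (2 * \<mu>)"
      using assms by simp
    then have "0 \<le> (norm (grad_f u))\<^sup>2 / (2 * \<mu>) - norm (grad_f u) * norm (v - u)
        + 1/2 * \<mu> * (norm (v - u))\<^sup>2"
      using assms(1) by (simp add: power2_eq_square field_simps)
    ultimately show ?thesis using assms(2)[of v] by linarith
  qed
  then have "f u - (norm (grad_f u))\<^sup>2 / (2 * \<mu>) \<le> Inf (range f)"
    by (intro cINF_greatest) auto
  then show ?thesis using assms(1) by (simp add: field_simps)
qed

lemma card_le_of_potential_decrease: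
  fixes \<Phi> :: "nat \<Rightarrow> real"
  assumes "\<And>k. k < n \<Longrightarrow> \<Phi> (Suc k) \<le> \<Phi> k" "\<And>k. k < n \<Longrightarrow> P k \<Longrightarrow> \<Phi> (Suc k) + 1 \<le> \<Phi> k"
  shows "real (card {k. P k \<and> k < n}) \<le> \<Phi> 0 - \<Phi> n"
  using assms
proof (induction n)
  case (Suc n)
  have *: "{k. P k \<and> k < Suc n} = (if P n then insert n {k. P k \<and> k < n} else {k. P k \<and> k < n})"
    by (auto simp: less_Suc_eq)
  have "real (card {k. P k \<and> k < n}) \<le> \<Phi> 0 - \<Phi> n"
    using Suc by simp
  moreover have "\<Phi> (Suc n) \<le> \<Phi> n" "P n \<Longrightarrow> \<Phi> (Suc n) + 1 \<le> \<Phi> n"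
    using Suc.prems by auto
  ultimately show ?case by (auto simp: *)
qed simp

section \<open>Iteration count for the trust-region run\<close>

theorem theorem4p11:
  fixes f :: "real^'n \<Rightarrow> real" and grad_f :: "real^'n \<Rightarrow> real^'n"
    and x s :: "nat \<Rightarrow> real^'n" and B :: "nat \<Rightarrow> real^'n^'n" and \<Delta> \<delta> :: "nat \<Rightarrow> real"
    and \<alpha> L0 L1 b0 b1 \<mu> \<epsilon> f_low \<theta>min \<kappa>0 \<kappa>\<alpha> :: real
    and \<kappa>mdc \<eta>1 \<eta>2 \<gamma>1 \<gamma>2 \<gamma>3 :: real
    and khat :: nat and S :: "nat set"
  assumes "bdd_below (range f)" and "f_low = Inf (range f)"
    and "0 \<le> \<alpha>" "\<alpha> \<le> 1" and "0 \<le> L0" "0 \<le> L1"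
    and "general_smooth \<alpha> L0 L1 f grad_f"
    and "tr_constants \<kappa>mdc \<eta>1 \<eta>2 \<gamma>1 \<gamma>2 \<gamma>3"
    and "trust_region_run \<kappa>mdc \<eta>1 \<eta>2 \<gamma>1 \<gamma>2 \<gamma>3 f grad_f x B s \<Delta>"
    and "0 \<le> b0" "0 \<le> b1" "b0 \<le> L0" "b1 \<le> L1"
    and "\<And>k. mat_norm (B k) \<le> b0 + b1 * pow0 (norm (grad_f (x k))) \<alpha>"
    and "0 < \<mu>"
    and "\<And>u v. f v \<ge> f u + grad_f u \<bullet> (v - u) + 1/2 * \<mu> * (norm (v - u))\<^sup>2"
    and "infinite (successful_iterations \<eta>1 f grad_f x B s)"
    and "\<delta> = (\<lambda>k. f (x k) - f_low)"
    and "0 < \<epsilon>" "\<epsilon> < 1"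
    and "is_first_crossing \<delta> \<epsilon> khat"
    and "S = {k \<in> successful_iterations \<eta>1 f grad_f x B s. k < khat}"
    and "\<theta>min = theta_min \<alpha> L0 L1 \<kappa>mdc \<eta>2 \<gamma>1 (\<Delta> 0) (norm (grad_f (x 0)))"
    and "\<kappa>0 = 1 / (2 * \<mu> * \<eta>1 * \<kappa>mdc\<^sup>2 * (1 - \<eta>2) * \<theta>min)"
    and "\<kappa>\<alpha> = L1 * (1 + pow0 (\<kappa>mdc * (1 - \<eta>2)) \<alpha>) * \<kappa>0"
  shows "(\<alpha> = 0 \<longrightarrow> real (card S) \<le> (L0 + 2 * L1) * \<kappa>0 * ln (\<delta> 0 / \<epsilon>)) \<and>
         (0 < \<alpha> \<longrightarrow> real (card S) \<le> L0 * \<kappa>0 * ln (\<delta> 0 / \<epsilon>)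
            + 2 powr (1 + \<alpha>/2) * \<kappa>\<alpha> * \<mu> powr (\<alpha>/2) / \<alpha>
                * (\<delta> 0 powr (\<alpha>/2) - \<epsilon> powr (\<alpha>/2)))"
proof -
  define c where "c = \<kappa>mdc * (1 - \<eta>2)"
  define b where "b = (\<lambda>k. norm (grad_f (x k)))"
  define \<beta> where "\<beta> = (\<lambda>k. sqrt (2 * \<mu> * \<delta> k))"
  define r where "r = radius_bound \<alpha> L0 L1 c"
  define q where "q = 1 + pow0 c \<alpha>"
  note run = assms(9)[unfolded trust_region_run_def Let_def]
  have tc: "0 < \<kappa>mdc" "\<kappa>mdc \<le> 1/2" "0 < \<eta>1" "\<eta>1 \<le> \<eta>2" "\<eta>2 < 1" "0 < \<gamma>1" "\<gamma>1 \<le> \<gamma>2" "\<gamma>2 < 1" "1 \<le> \<gamma>3"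
    using assms(8) by (auto simp: tr_constants_def)
  note par = \<open>0 \<le> \<alpha>\<close> \<open>\<alpha> \<le> 1\<close> \<open>0 \<le> L0\<close> \<open>0 \<le> L1\<close>
  note smooth = assms(7)
  have L: "L0 > 0 \<or> L1 > 0" using smooth by (simp add: general_smooth_def)
  have c: "0 < c" "c \<le> 1" using tc by (auto simp: c_def mult_le_one)
  have q: "1 \<le> q" by (simp add: q_def pow0_nonneg)
  \<comment> \<open>Positivity of the radius is a premise here because it is itself obtained from
    this bound by induction.\<close>
  have \<Delta>_Suc_if: "\<gamma>1 * \<Delta> k \<le> \<Delta> (Suc k)" if "0 < \<Delta> k" for k
  proof -
    have "\<gamma>2 * \<Delta> k \<le> \<Delta> k" "\<gamma>1 * \<Delta> k \<le> \<gamma>2 * \<Delta> k"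
      using tc that by auto
    moreover consider "\<eta>2 \<le> tr_ratio f grad_f x B s k" | "tr_ratio f grad_f x B s k < \<eta>1"
      | "\<eta>1 \<le> tr_ratio f grad_f x B s k" "tr_ratio f grad_f x B s k < \<eta>2"
      by linarith
    then have "\<Delta> k \<le> \<Delta> (Suc k) \<or> \<gamma>1 * \<Delta> k \<le> \<Delta> (Suc k) \<or> \<gamma>2 * \<Delta> k \<le> \<Delta> (Suc k)"
      by cases (use run in auto)
    ultimately show ?thesis by linarith
  qed
  have \<Delta>pos: "0 < \<Delta> k" for k
  proof (induction k)
    case 0
    then show ?case using run by simp
  next
    case (Suc k)
    then show ?case
      using \<Delta>_Suc_if[of k] tc mult_pos_pos[of \<gamma>1 "\<Delta> k"] by linarith
  qed
  note \<Delta>_Suc = \<Delta>_Suc_if[OF \<Delta>pos]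
  have dec: "\<kappa>mdc * b k * decrease_radius (grad_f (x k)) (B k) (\<Delta> k)
      \<le> tr_model f grad_f (x k) (B k) 0 - tr_model f grad_f (x k) (B k) (s k)" for k
    using run by (simp add: b_def)
  have succ: "\<eta>1 * (\<kappa>mdc * b k * decrease_radius (grad_f (x k)) (B k) (\<Delta> k)) \<le> \<delta> k - \<delta> (Suc k)"
    if "\<eta>1 \<le> tr_ratio f grad_f x B s k" for k
  proof -
    have "x (Suc k) = x k + s k" using run that by simp
    moreover have "0 \<le> decrease_radius (grad_f (x k)) (B k) (\<Delta> k)"
      using \<Delta>pos[of k] by (simp add: decrease_radius_nonneg)
    ultimately show ?thesis
      using successful_decrease[OF tc(3) that dec] tc by (simp add: assms(18) b_def)
  qed
  have \<delta>_Suc: "\<delta> (Suc k) \<le> \<delta> k" for k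
  proof (cases "\<eta>1 \<le> tr_ratio f grad_f x B s k")
    case True
    have "0 \<le> \<eta>1 * (\<kappa>mdc * b k * decrease_radius (grad_f (x k)) (B k) (\<Delta> k))"
      using tc \<Delta>pos[of k] by (simp add: b_def decrease_radius_nonneg)
    then show ?thesis using succ[OF True] by simp
  next
    case False
    then have "x (Suc k) = x k" using run by simp
    then show ?thesis by (simp add: assms(18))
  qed
  then have anti: "\<delta> n \<le> \<delta> m" if "m \<le> n" for m n
    using that by (rule lift_Suc_antimono_le)
  have khat: "\<epsilon> < \<delta> khat" using assms(21) by (simp add: is_first_crossing_def)
  \<comment> \<open>The logarithm and \<open>r\<close> need positive arguments. After
    \<open>khat\<close> the gap may vanish, so the invariants are stated up to and including
    \<open>khat\<close>; this also covers \<open>Suc k\<close> for \<open>k < khat\<close>.\<close>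
  have \<delta>pos: "0 < \<delta> k" if "k \<le> khat" for k
    using anti[OF that] khat assms(19) by simp
  have \<beta>pos: "0 < \<beta> k" if "k \<le> khat" for k
    using \<delta>pos[OF that] assms(15) by (simp add: \<beta>_def)
  have \<beta>b: "\<beta> k \<le> b k" for k
    using strongly_convex_gradient_domination[OF assms(15,16), where u = "x k"]
    by (auto simp: \<beta>_def b_def assms(2,18) intro!: real_le_lsqrt)
  have bpos: "0 < b k" if "k \<le> khat" for k
    using \<beta>pos[OF that] \<beta>b[of k] by simp
  have rmono: "r u \<le> r v" if "0 < u" "u \<le> v" for u v
    unfolding r_def using radius_bound_mono par L that c by blast
  have rpos: "0 < r u" if "0 < u" for u
    unfolding r_def using radius_bound_pos par L that c by blast
  have mat_le: "mat_norm (B k) \<le> L0 + L1 * pow0 (b k) \<alpha>" for k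
    using assms(14)[of k] assms(12) mult_right_mono[OF assms(13), of "pow0 (b k) \<alpha>"]
    by (simp add: b_def pow0_nonneg)

  \<comment> \<open>Lower bound on the radii\<close>
  define h0 where "h0 = h_aux \<alpha> L0 L1 (b 0) (c * psi_aux \<alpha> L0 L1 (b 0))"
  have h0: "r (b 0) \<le> h0"
    unfolding h0_def r_def using h_aux_ge_radius_bound par L bpos[of 0] c by blast
  have h0pos: "0 < h0" using h0 rpos[OF bpos[of 0]] by simp
  have \<theta>: "\<theta>min = \<gamma>1 * min 1 (\<Delta> 0 / h0)"
    by (simp add: assms(23) theta_min_def h0_def b_def c_def)
  have \<theta>pos: "0 < \<theta>min" using tc \<Delta>pos[of 0] h0pos by (simp add: \<theta>)
  have \<theta>\<gamma>: "\<theta>min \<le> \<gamma>1" using tc mult_left_mono[of "min 1 (\<Delta> 0 / h0)" 1 \<gamma>1] by (simp add: \<theta>)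
  have \<theta>1: "\<theta>min \<le> 1" using \<theta>\<gamma> tc by simp

  have radius: "\<theta>min * r (\<beta> k) \<le> \<Delta> k" if "k \<le> khat" for k
    using that
  proof (induction k)
    case 0
    \<comment> \<open>The second term of the minimum in \<open>\<theta>min\<close> is made for the
      start of the induction: \<open>\<theta>min * h0\<close> is at most the initial radius.\<close>
    have "\<theta>min * r (\<beta> 0) \<le> \<theta>min * h0"
      using rmono[OF \<beta>pos[of 0] \<beta>b] h0 \<theta>pos by (intro mult_left_mono) auto
    also have "\<dots> \<le> 1 * (\<Delta> 0 / h0) * h0"
      unfolding \<theta> using tc h0pos \<Delta>pos[of 0] by (intro mult_right_mono mult_mono) auto
    finally show ?case using h0pos by simp
  next
    case (Suc k)
    have k: "k \<le> khat" using Suc by simp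
    have le: "r (\<beta> (Suc k)) \<le> r (\<beta> k)"
      using \<delta>_Suc[of k] assms(15) by (intro rmono \<beta>pos Suc) (simp add: \<beta>_def)
    show ?case
    proof (cases "\<eta>2 \<le> tr_ratio f grad_f x B s k")
      case True
      then have "\<Delta> k \<le> \<Delta> (Suc k)" using run by simp
      moreover have "\<theta>min * r (\<beta> (Suc k)) \<le> \<theta>min * r (\<beta> k)" using le \<theta>pos by simp
      ultimately show ?thesis using Suc.IH[OF k] by linarith
    next
      case False
      \<comment> \<open>A radius of at most \<open>r (b k)\<close> would force a ratio of at least
        \<open>\<eta>2\<close>. So the radius can shrink only when it exceeds
        \<open>r (b k)\<close>, and then by no factor below \<open>\<gamma>1\<close>, which is at
        least \<open>\<theta>min\<close>.\<close>
      have "r (b k) < \<Delta> k"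
      proof (rule ccontr)
        assume "\<not> r (b k) < \<Delta> k"
        then have "\<eta>2 \<le> tr_ratio f grad_f x B s k"
          using bpos[OF k] tc \<Delta>pos[of k] mat_le[of k] dec[of k] run
          by (intro tr_ratio_ge_of_small_radius[OF smooth par, where \<kappa> = \<kappa>mdc and \<Delta> = "\<Delta> k"])
            (auto simp: b_def r_def c_def)
        then show False using False by simp
      qed
      then have "r (\<beta> (Suc k)) \<le> \<Delta> k" using le rmono[OF \<beta>pos[OF k] \<beta>b] by simp
      then have "\<theta>min * r (\<beta> (Suc k)) \<le> \<gamma>1 * \<Delta> k"
        using \<theta>\<gamma> \<theta>pos tc rpos[OF \<beta>pos[OF Suc.prems]] by (intro mult_mono) auto
      also have "\<gamma>1 * \<Delta> k \<le> \<Delta> (Suc k)" by (rule \<Delta>_Suc)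
      finally show ?thesis .
    qed
  qed

  \<comment> \<open>Relative decrease of the gap in a successful iteration\<close>
  define K where "K = \<eta>1 * \<kappa>mdc * c * \<theta>min"
  have Kpos: "0 < K" using tc c \<theta>pos by (simp add: K_def)
  \<comment> \<open>One factor \<open>\<kappa>mdc\<close> comes from the decrease condition and one
    from \<open>c\<close>; the factor \<open>2 * \<mu>\<close> comes from the square of
    \<open>\<beta> k\<close>.\<close>
  have \<kappa>0: "\<kappa>0 = 1 / (2 * \<mu> * K)"
    by (simp add: assms(24) K_def c_def power2_eq_square algebra_simps)
  have \<kappa>0pos: "0 < \<kappa>0" using Kpos assms(15) by (simp add: \<kappa>0)
  have step: "1 \<le> \<kappa>0 * (L0 + L1 * q * pow0 (\<beta> k) \<alpha>) * ((\<delta> k - \<delta> (Suc k)) / \<delta> k)"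
    if k: "k < khat" and S: "\<eta>1 \<le> tr_ratio f grad_f x B s k" for k
  proof -
    define D where "D = L0 + L1 * q * pow0 (\<beta> k) \<alpha>"
    have k': "k \<le> khat" using k by simp
    have D: "0 < D" unfolding D_def using smooth_coeff_pos par L \<beta>pos[OF k'] q by simp
    have r: "r (\<beta> k) = c * \<beta> k / D" by (simp add: r_def radius_bound_def D_def q_def)
    have bA: "0 < L0 + L1 * pow0 (b k) \<alpha>"
      using smooth_coeff_pos[of L0 L1 "b k" 1 \<alpha>] par L bpos[OF k'] by simp
    \<comment> \<open>The radius invariant handles one term of the minimum in the decrease
      condition. The other is handled by \<open>\<theta>min \<le> 1\<close>,
      \<open>c \<le> 1\<close> and the monotonicity of \<psi>, which replaces
      \<open>\<beta> k\<close> by \<open>b k\<close>.\<close>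
    have "\<theta>min * r (\<beta> k) \<le> 1 * r (\<beta> k)"
      using \<theta>1 rpos[OF \<beta>pos[OF k']] by (intro mult_right_mono) auto
    also have "\<dots> \<le> c * (\<beta> k / (L0 + L1 * pow0 (\<beta> k) \<alpha>))"
      unfolding r_def using radius_bound_le[of L0 L1 "\<beta> k" c \<alpha>] par L \<beta>pos[OF k'] c by simp
    also have "\<dots> \<le> 1 * (b k / (L0 + L1 * pow0 (b k) \<alpha>))"
      using ratio_mono[of L0 L1 \<alpha> "\<beta> k" "b k" 1] par L \<beta>pos[OF k'] \<beta>b[of k] c bA
        smooth_coeff_pos[of L0 L1 "\<beta> k" 1 \<alpha>]
      by (intro mult_mono) auto
    finally have "\<theta>min * r (\<beta> k) \<le> min (b k / (L0 + L1 * pow0 (b k) \<alpha>)) (\<Delta> k)"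
      using radius[OF k'] by simp
    also have "\<dots> \<le> decrease_radius (grad_f (x k)) (B k) (\<Delta> k)"
      using decrease_radius_ge[OF mat_le bA] by (simp add: b_def)
    finally have "\<eta>1 * (\<kappa>mdc * \<beta> k * (\<theta>min * r (\<beta> k))) \<le>
        \<eta>1 * (\<kappa>mdc * b k * decrease_radius (grad_f (x k)) (B k) (\<Delta> k))"
      using tc \<beta>b[of k] \<beta>pos[OF k'] \<theta>pos rpos[OF \<beta>pos[OF k']]
      by (intro mult_left_mono mult_mono) auto
    also have "\<dots> \<le> \<delta> k - \<delta> (Suc k)" by (rule succ[OF S])
    finally have "K * (\<beta> k)\<^sup>2 / D \<le> \<delta> k - \<delta> (Suc k)"
      by (simp add: r K_def power2_eq_square algebra_simps)
    moreover have "(\<beta> k)\<^sup>2 = 2 * \<mu> * \<delta> k"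
      using \<delta>pos[OF k'] assms(15) by (simp add: \<beta>_def)
    ultimately show ?thesis
      unfolding D_def[symmetric] \<kappa>0 using D Kpos assms(15) \<delta>pos[OF k'] by (simp add: field_simps)
  qed

  \<comment> \<open>Telescoping over the successful iterations\<close>
  have S: "S = {k. \<eta>1 \<le> tr_ratio f grad_f x B s k \<and> k < khat}"
    by (auto simp: assms(22) successful_iterations_def)
  have ln_step: "(\<delta> k - \<delta> (Suc k)) / \<delta> k \<le> ln (\<delta> k) - ln (\<delta> (Suc k))" if "k < khat" for k
  proof -
    have "0 < \<delta> k" "0 < \<delta> (Suc k)" using that by (auto intro!: \<delta>pos)
    moreover from this have "ln (\<delta> (Suc k) / \<delta> k) \<le> \<delta> (Suc k) / \<delta> k - 1"
      by (intro ln_le_minus_one) auto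
    ultimately show ?thesis by (simp add: ln_div field_simps)
  qed
  have ln_mono: "ln (\<delta> (Suc k)) \<le> ln (\<delta> k)" if "k < khat" for k
    using \<delta>_Suc[of k] \<delta>pos[of "Suc k"] that by simp
  \<comment> \<open>Only iterations before \<open>khat\<close> are counted, so the sum ends at
    \<open>\<delta> khat\<close>, which still exceeds \<epsilon>.\<close>
  have ln_final: "ln (\<delta> 0) - ln (\<delta> khat) \<le> ln (\<delta> 0 / \<epsilon>)"
    using khat \<delta>pos[of 0] assms(19) by (simp add: ln_div)
  show ?thesis
  proof (intro conjI impI)
    assume \<alpha>: "\<alpha> = 0"
    define \<Phi> where "\<Phi> = (\<lambda>k. (L0 + 2 * L1) * \<kappa>0 * ln (\<delta> k))"
    have C: "0 \<le> (L0 + 2 * L1) * \<kappa>0" using par \<kappa>0pos by simp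
    \<comment> \<open>In particular \<open>q = 2\<close>, which yields the coefficient
      \<open>L0 + 2 * L1\<close>.\<close>
    have one: "pow0 u \<alpha> = 1" for u by (simp add: pow0_def \<alpha>)
    have "real (card S) \<le> \<Phi> 0 - \<Phi> khat"
      unfolding S
    proof (rule card_le_of_potential_decrease)
      show "\<Phi> (Suc k) \<le> \<Phi> k" if "k < khat" for k
        unfolding \<Phi>_def using C ln_mono[OF that] by (rule mult_left_mono[rotated])
      show "\<Phi> (Suc k) + 1 \<le> \<Phi> k" if "k < khat" "\<eta>1 \<le> tr_ratio f grad_f x B s k" for k
        using step[OF that] mult_left_mono[OF ln_step[OF that(1)] C]
        by (simp add: \<Phi>_def q_def one algebra_simps)
    qed
    also have "\<dots> \<le> (L0 + 2 * L1) * \<kappa>0 * ln (\<delta> 0 / \<epsilon>)"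
      using mult_left_mono[OF ln_final C] by (simp add: \<Phi>_def right_diff_distrib)
    finally show "real (card S) \<le> (L0 + 2 * L1) * \<kappa>0 * ln (\<delta> 0 / \<epsilon>)" .
  next
    assume \<alpha>: "0 < \<alpha>"
    define p where "p = \<alpha> / 2"
    define W where "W = L1 * q * \<kappa>0 * (2 * \<mu>) powr p"
    \<comment> \<open>An antiderivative of \<open>L0 * \<kappa>0 / t + W * t powr (p - 1)\<close>,
      evaluated at \<open>\<delta> k\<close>. The constant \<open>W\<close> absorbs
      \<open>(2 * \<mu>) powr p\<close>, because \<open>\<beta> k powr \<alpha>\<close> equals
      \<open>(2 * \<mu> * \<delta> k) powr p\<close>.\<close>
    define \<Phi> where "\<Phi> = (\<lambda>k. L0 * \<kappa>0 * ln (\<delta> k) + W / p * \<delta> k powr p)"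
    have p: "0 < p" "p \<le> 1" using \<alpha> par by (auto simp: p_def)
    have C: "0 \<le> L0 * \<kappa>0" "0 \<le> W" using par \<kappa>0pos q by (auto simp: W_def)
    have "real (card S) \<le> \<Phi> 0 - \<Phi> khat"
      unfolding S
    proof (rule card_le_of_potential_decrease)
      show "\<Phi> (Suc k) \<le> \<Phi> k" if "k < khat" for k
        unfolding \<Phi>_def using C p ln_mono[OF that] \<delta>_Suc[of k] \<delta>pos[of "Suc k"] that
        by (intro add_mono mult_left_mono powr_mono2) auto
      show "\<Phi> (Suc k) + 1 \<le> \<Phi> k" if k: "k < khat" "\<eta>1 \<le> tr_ratio f grad_f x B s k" for k
      proof -
        have pos: "0 < \<delta> k" "0 < \<delta> (Suc k)" using k by (auto intro!: \<delta>pos)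
        have "pow0 (\<beta> k) \<alpha> = (2 * \<mu>) powr p * \<delta> k powr p"
          using \<alpha> pos assms(15)
          by (simp add: pow0_def \<beta>_def p_def powr_half_sqrt[symmetric] powr_powr powr_mult)
        then have "1 \<le> L0 * \<kappa>0 * ((\<delta> k - \<delta> (Suc k)) / \<delta> k)
            + W * ((\<delta> k - \<delta> (Suc k)) * \<delta> k powr p / \<delta> k)"
          using step[OF k] by (simp add: W_def algebra_simps add_divide_distrib)
        also have "\<dots> \<le> L0 * \<kappa>0 * (ln (\<delta> k) - ln (\<delta> (Suc k)))
            + W * ((\<delta> k powr p - \<delta> (Suc k) powr p) / p)"
          using C ln_step[OF k(1)] powr_diff_ge[OF pos(2,1) p] by (intro add_mono mult_left_mono)
        finally show ?thesis by (simp add: \<Phi>_def algebra_simps diff_divide_distrib)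
      qed
    qed
    also have "\<dots> = L0 * \<kappa>0 * (ln (\<delta> 0) - ln (\<delta> khat)) + W / p * (\<delta> 0 powr p - \<delta> khat powr p)"
      by (simp add: \<Phi>_def algebra_simps)
    also have "\<dots> \<le> L0 * \<kappa>0 * ln (\<delta> 0 / \<epsilon>) + W / p * (\<delta> 0 powr p - \<epsilon> powr p)"
      using C p ln_final khat assms(19)
      by (intro add_mono mult_left_mono diff_left_mono powr_mono2) auto
    \<comment> \<open>Dividing by \<open>p = \<alpha> / 2\<close> supplies the additional factor 2
      in \<open>2 powr (1 + \<alpha>/2)\<close>.\<close>
    also have "W / p = 2 powr (1 + \<alpha>/2) * \<kappa>\<alpha> * \<mu> powr (\<alpha>/2) / \<alpha>"
      using assms(15) \<alpha>
      by (simp add: W_def p_def assms(25) q_def c_def powr_mult powr_add)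
    finally show "real (card S) \<le> L0 * \<kappa>0 * ln (\<delta> 0 / \<epsilon>)
            + 2 powr (1 + \<alpha>/2) * \<kappa>\<alpha> * \<mu> powr (\<alpha>/2) / \<alpha>
                * (\<delta> 0 powr (\<alpha>/2) - \<epsilon> powr (\<alpha>/2))"
      by (simp add: p_def)
  qed
qed

end
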